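(* Let $R$ be a Noetherian integral domain. If $R$ satisfies the property (P), then the (Krull) dimension of $R$ is $\leq 1$.
   Context: All rings are commutative with identity $1\neq 0$. A ring $R$ satisfies the property (P) if whenever $I \subsetneq J$ are ideals of $R$, one has $I^n \subsetneq J^n$ for all $n \geq 1$. *)

theory Defs
  imports "HOL-Algebra.Algebra" "HOL-Library.Extended_Nat"
begin

text \<open>
  The \<open>n\<close>-th power of an ideal is the library's monoid power in the semiring
  \<^term>\<open>ideals_set R\<close> of ideals of \<open>R\<close>, whose multiplication is
  \<^const>\<open>ideal_prod\<close> and whose unit is \<^term>\<open>carrier R\<close>.
  The larger ideal \<open>J\<close> may be the unit ideal.
\<close>

definition property_P :: "('a, 'b) ring_scheme \<Rightarrow> bool" where
  "property_P R \<longleftrightarrow>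
     (\<forall>I J. ideal I R \<longrightarrow> ideal J R \<longrightarrow> I \<subset> J \<longrightarrow>
       (\<forall>n::nat. n \<ge> 1 \<longrightarrow>
          I [^]\<^bsub>ideals_set R\<^esub> n \<subset> J [^]\<^bsub>ideals_set R\<^esub> n))"

definition prime_chain :: "('a, 'b) ring_scheme \<Rightarrow> nat \<Rightarrow> (nat \<Rightarrow> 'a set) \<Rightarrow> bool" where
  "prime_chain R n p \<longleftrightarrow>
     (\<forall>i\<le>n. primeideal (p i) R) \<and> (\<forall>i<n. p i \<subset> p (Suc i))"

text \<open>
  A chain \<open>p 0 \<subset> \<dots> \<subset> p n\<close> has length \<open>n\<close>: the strict inclusions are counted.
  The supremum is \<open>\<infinity>\<close> if the lengths are unbounded. The zero ring, which has no prime
  ideals, would get the value \<open>0\<close>; rings here satisfy \<open>1 \<noteq> 0\<close>.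
\<close>

definition krull_dim :: "('a, 'b) ring_scheme \<Rightarrow> enat" where
  "krull_dim R = Sup {enat n | n. \<exists>p. prime_chain R n p}"

end

theory Submission
  imports Defs
begin

text \<open>
  Suppose that \<open>p\<^sub>0 \<subset> p\<^sub>1 \<subset> p\<^sub>2\<close> are primes, \<open>d \<in> p\<^sub>1 - p\<^sub>0\<close> and \<open>b \<in> p\<^sub>2 - p\<^sub>1\<close>.
  For all \<open>x\<close>, \<open>y\<close> the ideals \<open>I = (x\<^sup>4, x\<^sup>3y, xy\<^sup>3, y\<^sup>4)\<close> and \<open>J = I + (x\<^sup>2y\<^sup>2)\<close> have the same square,
  so property (P) gives \<open>x\<^sup>2y\<^sup>2 \<in> I\<close>. As \<open>R\<close> is Noetherian, the ideals \<open>(d : b\<^sup>n)\<close> are all contained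
  in \<open>(d : c)\<close> for some power \<open>c\<close> of \<open>b\<close>. Taking \<open>x = d\<close>, \<open>y = bc\<close> and cancelling \<open>d\<close> twice by means
  of this stability, one finds \<open>y\<^sup>2(1 - bv) \<in> (d) \<subseteq> p\<^sub>1\<close> for some \<open>v\<close>. Since \<open>y \<notin> p\<^sub>1\<close>, this puts
  \<open>1 - bv\<close>, and hence \<open>1\<close>, into \<open>p\<^sub>2\<close>.
\<close>

lemma (in cring) colon_ideal:
  assumes K: "ideal K R" and x: "x \<in> carrier R"
  shows "ideal {r \<in> carrier R. x \<otimes> r \<in> K} R"
proof (rule idealI[OF ring_axioms])
  interpret K: ideal K R by (rule K)
  have "x \<otimes> (\<ominus> r) = \<ominus> (x \<otimes> r)" if "r \<in> carrier R" for r
    using x that by (rule r_minus)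
  then show "subgroup {r \<in> carrier R. x \<otimes> r \<in> K} (add_monoid R)"
    using x by (intro add.subgroupI) (auto simp: r_distr a_inv_def[symmetric] intro: exI[of _ \<zero>])
  show "y \<otimes> a \<in> {r \<in> carrier R. x \<otimes> r \<in> K}" 
    if "a \<in> {r \<in> carrier R. x \<otimes> r \<in> K}" "y \<in> carrier R" for a y
    using that x K.I_l_closed[of "x \<otimes> a" y] by (simp add: m_lcomm)
  show "a \<otimes> y \<in> {r \<in> carrier R. x \<otimes> r \<in> K}" 
    if "a \<in> {r \<in> carrier R. x \<otimes> r \<in> K}" "y \<in> carrier R" for a y
    using that x K.I_r_closed[of "x \<otimes> a" y] by (simp add: m_assoc)
qed

text \<open>The colon ideal is used once in each argument: for fixed \<open>s \<in> S\<close> the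
  ideal \<open>(K : s)\<close> contains \<open>T\<close>, hence \<open>Idl T\<close>; then for fixed
  \<open>t \<in> Idl T\<close> the ideal \<open>(K : t)\<close> contains \<open>S\<close>, hence
  \<open>Idl S\<close>.\<close>

lemma (in cring) ideal_prod_genideal_subset:
  assumes "S \<subseteq> carrier R" "T \<subseteq> carrier R" and K: "ideal K R"
    and ST: "\<And>s t. s \<in> S \<Longrightarrow> t \<in> T \<Longrightarrow> s \<otimes> t \<in> K"
  shows "(Idl S) \<cdot> (Idl T) \<subseteq> K"
proof -
  interpret K: ideal K R by (rule K)
  have T: "Idl T \<subseteq> {r \<in> carrier R. s \<otimes> r \<in> K}" if "s \<in> S" for s
    using that assms by (intro genideal_minimal colon_ideal) auto
  have S: "Idl S \<subseteq> {r \<in> carrier R. t \<otimes> r \<in> K}" if "t \<in> Idl T" for t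
  proof (rule genideal_minimal)
    have t: "t \<in> carrier R"
      using that genideal_minimal[OF oneideal assms(2)] by auto
    then show "ideal {r \<in> carrier R. t \<otimes> r \<in> K} R"
      by (rule colon_ideal[OF K])
    have "t \<otimes> s \<in> K" if "s \<in> S" for s
      using T[OF that] \<open>t \<in> Idl T\<close> m_comm[OF t subsetD[OF assms(1) that]] by auto
    then show "S \<subseteq> {r \<in> carrier R. t \<otimes> r \<in> K}"
      using assms(1) by auto
  qed
  show ?thesis
  proof
    fix x assume "x \<in> (Idl S) \<cdot> (Idl T)"
    then show "x \<in> K"
    proof (induct x rule: ideal_prod.induct)
      case (prod i j)
      then have "j \<in> carrier R"
        using genideal_minimal[OF oneideal assms(2)] by auto
      with S[OF prod(2)] prod(1) show ?case
        using m_comm by auto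
    qed simp
  qed
qed

text \<open>Splits off one generator, since the ideal is contained in
  \<open>PIdl a <+> Idl S\<close>. Iterating it turns membership in a finitely generated ideal into
  an explicit linear combination.\<close>

lemma (in cring) genideal_insertE:
  assumes "x \<in> Idl (insert a S)" "a \<in> carrier R" "S \<subseteq> carrier R"
  obtains c y where "c \<in> carrier R" "y \<in> Idl S" "x = c \<otimes> a \<oplus> y"
proof -
  have "PIdl a \<subseteq> carrier R" "Idl S \<subseteq> carrier R"
    using assms cgenideal_minimal genideal_minimal oneideal by simp_all
  then have "Idl (insert a S) \<subseteq> Idl (PIdl a \<union> Idl S)"
    using cgenideal_self[OF assms(2)] genideal_self[OF assms(3)]
    by (intro subset_Idl_subset) auto
  also have "\<dots> = PIdl a <+> Idl S"
    using assms by (intro union_genideal cgenideal_ideal genideal_ideal)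
  finally show ?thesis
    using assms(1) that unfolding set_add_def' cgenideal_def by blast
qed

lemma (in cring) property_P_relation:
  assumes P: "property_P R" and d: "d \<in> carrier R" and e: "e \<in> carrier R"
  obtains c0 c1 c3 c4 where
    "c0 \<in> carrier R" "c1 \<in> carrier R" "c3 \<in> carrier R" "c4 \<in> carrier R"
    "d [^] (2::nat) \<otimes> e [^] (2::nat) =
      c0 \<otimes> d [^] (4::nat) \<oplus> c1 \<otimes> (d [^] (3::nat) \<otimes> e)
      \<oplus> c3 \<otimes> (d \<otimes> e [^] (3::nat)) \<oplus> c4 \<otimes> e [^] (4::nat)"
proof -
  define S where "S = {d [^] (4::nat), d [^] (3::nat) \<otimes> e, d \<otimes> e [^] (3::nat), e [^] (4::nat)}"
  define z where "z = d [^] (2::nat) \<otimes> e [^] (2::nat)"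
  have S: "S \<subseteq> carrier R" and z: "z \<in> carrier R"
    using d e by (auto simp: S_def z_def)
  have I: "ideal (Idl S) R" and J: "ideal (Idl (insert z S)) R"
    using S z by (auto intro: genideal_ideal)
  have sub: "S \<subseteq> Idl S"
    using S by (rule genideal_self)
  have SS: "s \<otimes> t \<in> (Idl S) \<cdot> (Idl S)" if "s \<in> S" "t \<in> S" for s t
    using that sub by (intro ideal_prod.prod) auto
  have zS: "z \<otimes> s \<in> (Idl S) \<cdot> (Idl S)" if "s \<in> S" for s
  proof -
    \<comment> \<open>Each monomial of degree 8 is regrouped into two generators that avoid
      \<open>z\<close>, for instance \<open>d^6 e^2 = (d^3 e)^2\<close> and
      \<open>d^5 e^3 = d^4 (d e^3)\<close>.\<close>
    have "z \<otimes> d [^] (4::nat) = (d [^] (3::nat) \<otimes> e) \<otimes> (d [^] (3::nat) \<otimes> e)"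
      "z \<otimes> (d [^] (3::nat) \<otimes> e) = d [^] (4::nat) \<otimes> (d \<otimes> e [^] (3::nat))"
      "z \<otimes> (d \<otimes> e [^] (3::nat)) = (d [^] (3::nat) \<otimes> e) \<otimes> e [^] (4::nat)"
      "z \<otimes> e [^] (4::nat) = (d \<otimes> e [^] (3::nat)) \<otimes> (d \<otimes> e [^] (3::nat))"
      unfolding z_def using d e by (simp_all add: numeral_eq_Suc m_ac)
    with that show ?thesis
      using SS by (auto simp: S_def)
  qed
  have zz: "z \<otimes> z \<in> (Idl S) \<cdot> (Idl S)"
  proof -
    have "z \<otimes> z = d [^] (4::nat) \<otimes> e [^] (4::nat)"
      unfolding z_def using d e by (simp add: numeral_eq_Suc m_ac)
    then show ?thesis
      using SS by (auto simp: S_def)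
  qed
  have "(Idl (insert z S)) \<cdot> (Idl (insert z S)) \<subseteq> (Idl S) \<cdot> (Idl S)"
  proof (rule ideal_prod_genideal_subset)
    show "ideal ((Idl S) \<cdot> (Idl S)) R"
      using I I by (rule ideal_prod_is_ideal)
    fix s t assume st: "s \<in> insert z S" "t \<in> insert z S"
    consider "s = z" "t = z" | "s = z" "t \<in> S" | "s \<in> S" "t = z" | "s \<in> S" "t \<in> S"
      using st by blast
    then show "s \<otimes> t \<in> (Idl S) \<cdot> (Idl S)"
    proof cases
      case 3
      then show ?thesis
        using zS[of s] S z m_comm[of s z] by auto
    qed (use zz zS SS in auto)
  qed (use S z in auto)
  \<comment> \<open>The monoid power starts from the unit, so it unfolds to
    \<open>(carrier R \<cdot> K) \<cdot> K\<close>.\<close>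
  moreover have "K [^]\<^bsub>ideals_set R\<^esub> (2::nat) = K \<cdot> K" if "ideal K R" for K
    using that ideal_prod_one[of K] ideal_prod_commute[OF oneideal, of K]
    by (simp add: numeral_2_eq_2 nat_pow_def ideals_set_def)
  ultimately have "\<not> Idl S \<subset> Idl (insert z S)"
    using P I J unfolding property_P_def by (metis one_le_numeral leD)
  moreover have "Idl S \<subseteq> Idl (insert z S)"
    using S z by (intro subset_Idl_subset) auto
  ultimately have "z \<in> Idl S"
    using genideal_self[of "insert z S"] S z by blast
  \<comment> \<open>The four generators are split off one at a time; their coefficients are
    \<open>c0\<close>, \<open>c1\<close>, \<open>c3\<close>, \<open>c4\<close>.\<close>
  then obtain c0 y0 where 0: "c0 \<in> carrier R"
      "y0 \<in> Idl {d [^] (3::nat) \<otimes> e, d \<otimes> e [^] (3::nat), e [^] (4::nat)}"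
      "z = c0 \<otimes> d [^] (4::nat) \<oplus> y0"
    unfolding S_def by (rule genideal_insertE) (use d e in simp_all)
  from 0(2) obtain c1 y1 where 1: "c1 \<in> carrier R"
      "y1 \<in> Idl {d \<otimes> e [^] (3::nat), e [^] (4::nat)}"
      "y0 = c1 \<otimes> (d [^] (3::nat) \<otimes> e) \<oplus> y1"
    by (rule genideal_insertE) (use d e in simp_all)
  from 1(2) obtain c3 y3 where 3: "c3 \<in> carrier R"
      "y3 \<in> Idl {e [^] (4::nat)}"
      "y1 = c3 \<otimes> (d \<otimes> e [^] (3::nat)) \<oplus> y3"
    by (rule genideal_insertE) (use d e in simp_all)
  from 3(2) obtain c4 where 4: "c4 \<in> carrier R" "y3 = c4 \<otimes> e [^] (4::nat)"
    using e cgenideal_eq_genideal[of "e [^] (4::nat)"] by (auto simp: cgenideal_def)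
  show ?thesis
    using that[of c0 c1 c3 c4] 0 1 3 4 d e by (simp add: z_def a_assoc)
qed

text \<open>The colon ideals \<open>L n = (d : b^n)\<close> ascend, and in a Noetherian ring the
  union of a chain of ideals is a member of the chain, here \<open>L k\<close>. Thus one
  \<open>k\<close> serves all \<open>n\<close> and \<open>r\<close>.\<close>

lemma (in noetherian_domain) colon_powers_stable:
  assumes d: "d \<in> carrier R" and b: "b \<in> carrier R"
  obtains k :: nat where
    "\<And>n r. r \<in> carrier R \<Longrightarrow> d divides b [^] (n::nat) \<otimes> r \<Longrightarrow> d divides b [^] k \<otimes> r"
proof -
  define L where "L n = {r \<in> carrier R. b [^] (n::nat) \<otimes> r \<in> PIdl d}" for n
  have L: "ideal (L n) R" for n
    unfolding L_def using b d by (intro colon_ideal cgenideal_ideal) auto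
  have "L n \<subseteq> L (Suc n)" for n
  proof
    fix r assume r: "r \<in> L n"
    then have "b \<otimes> (b [^] n \<otimes> r) \<in> PIdl d"
      using b ideal.I_l_closed[OF cgenideal_ideal[OF d]] by (simp add: L_def)
    moreover have "b \<otimes> (b [^] n \<otimes> r) = b [^] Suc n \<otimes> r"
      using r b by (simp add: L_def m_ac)
    ultimately show "r \<in> L (Suc n)"
      using r by (simp add: L_def)
  qed
  then have "mono L"
    by (simp add: mono_iff_le_Suc)
  then have "L m \<subseteq> L n \<or> L n \<subseteq> L m" for m n
    by (metis monoD nat_le_linear)
  with L have "subset.chain {I. ideal I R} (range L)"
    unfolding subset_chain_def by blast
  then have "\<Union> (range L) \<in> range L"
    by (intro ideal_chain_is_trivial) auto
  then obtain k where "\<Union> (range L) = L k"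
    by blast
  then have k: "L n \<subseteq> L k" for n
    by blast
  have div: "d divides x \<longleftrightarrow> x \<in> PIdl d" for x
    using d by (auto simp: factor_def cgenideal_def m_comm)
  show ?thesis
    using k by (intro that[of k]) (auto simp: L_def div)
qed

lemma (in noetherian_domain) property_P_no_prime_chain:
  assumes P: "property_P R"
    and p0: "primeideal p0 R" and p1: "primeideal p1 R" and p2: "primeideal p2 R"
    and "p0 \<subset> p1" "p1 \<subset> p2"
  shows False
proof -
  interpret p1: primeideal p1 R by (rule p1)
  interpret p2: primeideal p2 R by (rule p2)
  obtain d where d: "d \<in> p1" "d \<notin> p0" "d \<in> carrier R"
    using \<open>p0 \<subset> p1\<close> p1.Icarr by blast
  obtain b where b: "b \<in> p2" "b \<notin> p1" "b \<in> carrier R"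
    using \<open>p1 \<subset> p2\<close> p2.Icarr by blast
  \<comment> \<open>The prime \<open>p0\<close> supplies \<open>d \<noteq> \<zero>\<close>, which
    the two cancellations below require.\<close>
  have "\<zero> \<in> p0"
    using p0 by (simp add: additive_subgroup.zero_closed ideal.axioms(1) primeideal.axioms(1))
  with d have "d \<noteq> \<zero>" by blast
  have pow: "b [^] n \<notin> p1" for n :: nat
  proof (induct n)
    case 0
    show ?case using p1.I_notcarr p1.one_imp_carrier by auto
  next
    case (Suc n)
    then show ?case using b p1.I_prime[of "b [^] n" b] by auto
  qed
  obtain k :: nat where
    k: "\<And>n r. r \<in> carrier R \<Longrightarrow> d divides b [^] (n::nat) \<otimes> r \<Longrightarrow> d divides b [^] k \<otimes> r"
    using colon_powers_stable[OF d(3) b(3)] by blast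
  \<comment> \<open>Powers of \<open>e\<close> are powers of \<open>b\<close>, so stability applies
    to them. Each factor \<open>e\<close> splits into \<open>c\<close>, which makes a coefficient
    divisible by \<open>d\<close>, and a spare \<open>b\<close>, which lies in
    \<open>p2\<close>.\<close>
  define c where "c = b [^] k"
  define e where "e = b \<otimes> c"
  have c: "c \<in> carrier R" and e: "e \<in> carrier R"
    using b by (auto simp: c_def e_def)
  have e_pow: "e = b [^] Suc k"
    using b by (simp add: e_def c_def m_comm)
  have stable: "\<exists>v\<in>carrier R. c \<otimes> r = d \<otimes> v"
    if "r \<in> carrier R" "t \<in> carrier R" "e [^] (n::nat) \<otimes> r = d \<otimes> t" for r t n
  proof -
    have "e [^] n = b [^] (Suc k * n)"
      unfolding e_pow using b by (intro nat_pow_pow)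
    then have "d divides b [^] (Suc k * n) \<otimes> r"
      using that by (auto simp: factor_def)
    from k[OF that(1) this] show ?thesis
      by (auto simp: c_def factor_def)
  qed
  obtain c0 c1 c3 c4 where
    cs: "c0 \<in> carrier R" "c1 \<in> carrier R" "c3 \<in> carrier R" "c4 \<in> carrier R" and
    rel: "d [^] (2::nat) \<otimes> e [^] (2::nat) =
      c0 \<otimes> d [^] (4::nat) \<oplus> c1 \<otimes> (d [^] (3::nat) \<otimes> e)
      \<oplus> c3 \<otimes> (d \<otimes> e [^] (3::nat)) \<oplus> c4 \<otimes> e [^] (4::nat)"
    using property_P_relation[OF P d(3) e] by blast
  \<comment> \<open>Collects the terms of \<open>rel\<close> that are visibly divisible by
    \<open>d^2\<close>; note that \<open>w\<close> is congruent to \<open>e^2\<close> modulo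
    \<open>d\<close>.\<close>
  define w where "w = e [^] (2::nat) \<ominus> d \<otimes> (c0 \<otimes> d \<oplus> c1 \<otimes> e)"
  have w: "w \<in> carrier R" using d e cs by (simp add: w_def)
  have dw: "d \<otimes> (d \<otimes> w) = d \<otimes> (c3 \<otimes> e [^] (3::nat)) \<oplus> c4 \<otimes> e [^] (4::nat)"
  proof -
    have "d \<otimes> (d \<otimes> w) = d [^] (2::nat) \<otimes> e [^] (2::nat)
        \<ominus> (c0 \<otimes> d [^] (4::nat) \<oplus> c1 \<otimes> (d [^] (3::nat) \<otimes> e))"
      using d e cs by (simp add: w_def numeral_eq_Suc minus_eq r_distr r_minus minus_add m_ac)
    moreover have "(x \<oplus> y \<oplus> y') \<ominus> x = y \<oplus> y'"
      if "x \<in> carrier R" "y \<in> carrier R" "y' \<in> carrier R" for x y y'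
      using that by (simp add: minus_eq a_assoc a_comm[of x] l_neg)
    ultimately show ?thesis
      unfolding rel using d e cs by (simp add: m_lcomm)
  qed
  \<comment> \<open>All other terms of \<open>dw\<close> contain \<open>d\<close>, so stability
    yields \<open>c c4 = d u\<close>.\<close>
  have e4: "e [^] (4::nat) \<otimes> c4 = d \<otimes> (d \<otimes> w \<ominus> c3 \<otimes> e [^] (3::nat))"
    using d e cs w dw by (simp add: minus_eq r_distr r_minus a_ac r_neg r_neg1 r_neg2 m_comm)
  then obtain u where u: "u \<in> carrier R" "c \<otimes> c4 = d \<otimes> u"
    using stable[OF cs(4) _ e4] cs d w e by auto
  \<comment> \<open>Writing \<open>e^4 = b e^3 c\<close> and replacing \<open>c c4\<close> by
    \<open>d u\<close> exposes a common factor \<open>d\<close>, which is cancelled.\<close>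
  have "d \<otimes> (d \<otimes> w) = d \<otimes> (c3 \<otimes> e [^] (3::nat)) \<oplus> b \<otimes> e [^] (3::nat) \<otimes> (c \<otimes> c4)"
    unfolding dw using b c e cs
    by (simp add: e_def[symmetric] numeral_eq_Suc m_ac) (simp add: e_def m_ac)
  also have "\<dots> = d \<otimes> (e [^] (3::nat) \<otimes> (c3 \<oplus> b \<otimes> u))"
    unfolding u(2) using b d e cs u(1) by (simp add: r_distr m_ac)
  finally have dw': "d \<otimes> w = e [^] (3::nat) \<otimes> (c3 \<oplus> b \<otimes> u)"
    using m_lcancel[OF \<open>d \<noteq> \<zero>\<close> d(3)] d(3) b(3) e cs w u(1) by simp
  \<comment> \<open>Second round of the same argument, now with \<open>e^3 = b e^2 c\<close>; it
    leaves \<open>w\<close> as a multiple of \<open>b e^2\<close>.\<close>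
  obtain v where v: "v \<in> carrier R" "c \<otimes> (c3 \<oplus> b \<otimes> u) = d \<otimes> v"
    using stable[of "c3 \<oplus> b \<otimes> u" w 3] dw' w cs b u by auto
  have "d \<otimes> w = b \<otimes> e [^] (2::nat) \<otimes> (c \<otimes> (c3 \<oplus> b \<otimes> u))"
    unfolding dw' using b c e cs u
    by (simp add: numeral_eq_Suc m_ac) (simp add: e_def m_ac)
  also have "\<dots> = d \<otimes> (b \<otimes> v \<otimes> e [^] (2::nat))"
    unfolding v(2) using b d e v(1) by (simp add: m_ac)
  finally have w_eq: "w = b \<otimes> v \<otimes> e [^] (2::nat)"
    using m_lcancel[OF \<open>d \<noteq> \<zero>\<close> d(3)] b(3) e w v(1) by simp
  \<comment> \<open>The two expressions for \<open>w\<close> are compared: their difference from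
    \<open>e^2\<close> is a multiple of \<open>d\<close>, hence in \<open>p1\<close>.\<close>
  have "e [^] (2::nat) \<otimes> (\<one> \<ominus> b \<otimes> v) = e [^] (2::nat) \<ominus> w"
    unfolding w_eq using e b v by (simp add: minus_eq r_distr r_minus m_ac)
  also have "\<dots> = d \<otimes> (c0 \<otimes> d \<oplus> c1 \<otimes> e)"
    unfolding w_def using d e cs by (simp add: minus_eq minus_add a_assoc[symmetric] r_neg)
  also have "\<dots> \<in> p1"
    using d e cs by (intro p1.I_r_closed) auto
  finally have "e [^] (2::nat) \<in> p1 \<or> \<one> \<ominus> b \<otimes> v \<in> p1"
    using e b v by (intro p1.I_prime) auto
  moreover have "e [^] (2::nat) \<notin> p1"
    unfolding e_pow nat_pow_pow[OF b(3)] by (rule pow)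
  ultimately have "\<one> \<ominus> b \<otimes> v \<in> p2"
    using \<open>p1 \<subset> p2\<close> by blast
  moreover have "b \<otimes> v \<in> p2"
    using b v by (simp add: p2.I_r_closed)
  ultimately have "(\<one> \<ominus> b \<otimes> v) \<oplus> b \<otimes> v \<in> p2"
    by (rule p2.a_closed)
  moreover have "(\<one> \<ominus> b \<otimes> v) \<oplus> b \<otimes> v = \<one>"
    using b v by (simp add: minus_eq a_assoc l_neg)
  ultimately show False
    using p2.one_imp_carrier p2.I_notcarr by simp
qed

theorem theorem16p2:
  fixes R :: "('a, 'b) ring_scheme"
  assumes "noetherian_domain R"
    and "property_P R"
  shows "krull_dim R \<le> 1"
proof -
  interpret noetherian_domain R by (rule assms(1))
  have "n \<le> 1" if "prime_chain R n p" for n p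
  proof (rule ccontr)
    \<comment> \<open>Length counts inclusions, so \<open>n \<ge> 2\<close> already provides three
      primes.\<close>
    assume "\<not> n \<le> 1"
    with that have "primeideal (p 0) R" "primeideal (p 1) R" "primeideal (p 2) R"
      "p 0 \<subset> p 1" "p 1 \<subset> p 2"
      by (auto simp: prime_chain_def numeral_2_eq_2)
    with property_P_no_prime_chain[OF assms(2)] show False by blast
  qed
  then show ?thesis
    by (auto simp: krull_dim_def one_enat_def intro!: Sup_least)
qed

end
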